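(* Let $\pi\in S_n$ have LTR-max decomposition $\pi=M_1P_1M_2$ with $M_2\neq\emptyset$, and let $m_1=|M_1|$, $p_1=|P_1|$, $m_2=|M_2|$. Then \[|q^{-1}(\pi)|=\sum_{i=1}^{m_2}\sum_{j=0}^{i-1}\binom{i-1}{j}\,b_{m_1+j+1,\,m_1}\,b_{m_2+p_1-j,\,m_2-i+1}.\]
   Context: $S_n$ is the set of permutations of $\{1,\dots,n\}$ in one-line notation. An entry $\pi_i$ is a left-to-right (LTR) maximum if $\pi_i>\pi_j$ for all $j<i$. The map $q:S_n\to S_n$ (the algorithm Queuesort, sorting with a queue allowing bypass): let $m_1,\dots,m_r$ be the LTR maxima of $\pi$ from left to right; for $i=r,\dots,1$ in this order, repeatedly swap $m_i$ with the entry immediately to its right as long as such an entry exists and is smaller than $m_i$; the result is $q(\pi)$. $q^{-1}(\pi)=\{\sigma: q(\sigma)=\pi\}$. The LTR-max decomposition $\pi=M_1P_1M_2$ means: $M_1$ is the maximal initial factor of consecutive LTR maxima, $P_1$ is a nonempty factor of non-LTR-maxima, and $M_2$ is the final factor consisting of LTR maxima, and these are all the LTR maxima. $S_n(321)$ is the set of $321$-avoiding permutations in $S_n$ (no $a<b<c$ with $\pi_a>\pi_b>\pi_c$). For $n\ge1$, $1\le i\le n$: $b_{n,i}=|\{\pi\in S_n(321):\pi_i=n\}|$. *)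

theory Defs
  imports Main "HOL-Combinatorics.Multiset_Permutations"
begin

text \<open>
  A permutation of size \<open>n\<close> is given in one-line notation as a list enumerating
  \<open>{1..n}\<close>. Entries have values \<open>1, \<dots>, n\<close>, but list positions are counted from \<open>0\<close>.
\<close>

definition perms :: "nat \<Rightarrow> nat list set" where
  "perms n = permutations_of_set {1..n}"

definition is_ltr_max :: "nat list \<Rightarrow> nat \<Rightarrow> bool" where
  "is_ltr_max xs i \<longleftrightarrow> i < length xs \<and> (\<forall>j<i. xs ! j < xs ! i)"

definition ltr_maxima :: "nat list \<Rightarrow> nat list" where
  "ltr_maxima xs = map (\<lambda>i. xs ! i) (filter (is_ltr_max xs) [0..<length xs])"

text \<open>
  \<open>push_right m ys\<close> starts with \<open>m\<close> immediately to the left of \<open>ys\<close> and swaps it with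
  its right neighbour as long as that neighbour exists and is smaller than \<open>m\<close>.
\<close>

fun push_right :: "nat \<Rightarrow> nat list \<Rightarrow> nat list" where
  "push_right m [] = [m]"
| "push_right m (y # ys) = (if y < m then y # push_right m ys else m # y # ys)"

definition bubble :: "nat \<Rightarrow> nat list \<Rightarrow> nat list" where
  "bubble m xs =
     takeWhile (\<lambda>x. x \<noteq> m) xs @ push_right m (tl (dropWhile (\<lambda>x. x \<noteq> m) xs))"

text \<open>
  The maxima to be moved are those of the input list; \<open>foldr\<close> treats them from the
  rightmost to the leftmost.
\<close>

definition queuesort :: "nat list \<Rightarrow> nat list" where
  "queuesort xs = foldr bubble (ltr_maxima xs) xs"

definition queuesort_preimage :: "nat \<Rightarrow> nat list \<Rightarrow> nat list set" where
  "queuesort_preimage n p = {s \<in> perms n. queuesort s = p}"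

text \<open>
  As \<open>P1\<close> is nonempty and contains no LTR maximum, the initial run \<open>M1\<close> of LTR maxima
  is automatically maximal.
\<close>

definition ltr_max_decomp ::
    "nat list \<Rightarrow> nat list \<Rightarrow> nat list \<Rightarrow> nat list \<Rightarrow> bool" where
  "ltr_max_decomp p M1 P1 M2 \<longleftrightarrow>
     p = M1 @ P1 @ M2 \<and> P1 \<noteq> [] \<and>
     (\<forall>i<length p. is_ltr_max p i \<longleftrightarrow> i < length M1 \<or> length M1 + length P1 \<le> i)"

definition avoids_321 :: "nat list \<Rightarrow> bool" where
  "avoids_321 p \<longleftrightarrow>
     \<not> (\<exists>a b c. a < b \<and> b < c \<and> c < length p \<and> p ! a > p ! b \<and> p ! b > p ! c)"

text \<open>Only used for \<open>1 \<le> i \<le> n\<close>; the \<open>i\<close>-th entry of \<open>p\<close> is \<open>p ! (i - 1)\<close>.\<close>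

definition b_num :: "nat \<Rightarrow> nat \<Rightarrow> nat" where
  "b_num n i = card {p \<in> perms n. avoids_321 p \<and> p ! (i - 1) = n}"

end

theory Submission
  imports Defs
begin

text \<open>
  Replacing every entry of a preimage of \<open>p\<close> by its position in \<open>p\<close> yields a \<open>321\<close>-avoiding
  permutation \<open>r\<close>: in Queuesort only left-to-right maxima move to the right, so every inversion
  of \<open>r\<close> consists of a maximum and a non-maximum. Moreover \<open>r\<close> has the same maxima, and a maximum
  must land on a left-to-right maximum of \<open>p\<close> that is last or followed by a larger entry.
  Conversely, every such \<open>r\<close> comes from a preimage. For \<open>p = M1 @ P1 @ M2\<close> the condition says
  that no value in \<open>{a..b}\<close> is a left-to-right maximum of \<open>r\<close>, where \<open>a = |M1|\<close> and
  \<open>b = |M1| + |P1|\<close>.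

  Cut such an \<open>r\<close> after the value \<open>a\<close>, and let \<open>q\<close> be the largest entry of the left part. The left
  part contains \<open>1, \<dots>, a\<close>, the entry \<open>q > b\<close>, and an arbitrary set \<open>J\<close> of entries strictly between
  \<open>b\<close> and \<open>q\<close>. The left part, and the right part with \<open>q\<close> put in front, are arbitrary
  \<open>321\<close>-avoiders with prescribed last and first entry, respectively. Taking inverses (and reverse
  complements) turns these into avoiders with a prescribed position of the maximum. In the
  theorem \<open>i = q - b\<close> and \<open>j = |J|\<close>.
\<close>

subsection \<open>Positions in a list\<close>

text \<open>For a list without repetition this is the inverse permutation, counted from 0. Comparing
  values of \<open>pos\<close> allows following an entry through Queuesort without carrying indices
  along.\<close>

definition pos :: "'a list \<Rightarrow> 'a \<Rightarrow> nat" where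
  "pos xs x = length (takeWhile (\<lambda>y. y \<noteq> x) xs)"

lemma pos_Nil [simp]: "pos [] x = 0"
  by (simp add: pos_def)

lemma pos_Cons [simp]: "pos (y # xs) x = (if y = x then 0 else Suc (pos xs x))"
  by (simp add: pos_def)

lemma pos_less_length [simp]: "pos xs x < length xs \<longleftrightarrow> x \<in> set xs"
  by (induction xs) auto

lemma nth_pos [simp]: "x \<in> set xs \<Longrightarrow> xs ! pos xs x = x"
  by (induction xs) auto

lemma pos_nth: "distinct xs \<Longrightarrow> i < length xs \<Longrightarrow> pos xs (xs ! i) = i"
  by (metis nth_eq_iff_index_eq nth_mem nth_pos pos_less_length)

lemma pos_append: "pos (xs @ ys) x = (if x \<in> set xs then pos xs x else length xs + pos ys x)"
  by (induction xs) auto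

lemma pos_eq_iff: "x \<in> set xs \<Longrightarrow> y \<in> set xs \<Longrightarrow> pos xs x = pos xs y \<longleftrightarrow> x = y"
  by (metis nth_pos)

lemma pos_map:
  "inj_on f (set xs) \<Longrightarrow> x \<in> set xs \<Longrightarrow> pos (map f xs) (f x) = pos xs x"
  by (induction xs) (auto simp: inj_on_def)

text \<open>The entries in front of \<open>v\<close> are exactly those related to it. A general
  \<open>R\<close> serves increasing and decreasing lists alike; the position becomes the rank that
  serves as an index of \<open>b_num\<close>.\<close>

lemma pos_sorted_wrt:
  assumes "sorted_wrt R X" "\<And>x y. R x y \<Longrightarrow> \<not> R y x" "v \<in> set X"
  shows "pos X v = card {y \<in> set X. R y v}"
proof -
  have *: "R (X ! i) (X ! j)" if "i < j" "j < length X" for i j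
    using assms(1) that by (simp add: sorted_wrt_iff_nth_less)
  have "inj_on ((!) X) {..<pos X v}"
    by (rule inj_onI)
      (metis * assms(2,3) lessThan_iff linorder_neqE_nat order_less_trans pos_less_length)
  moreover have "{y \<in> set X. R y v} = (!) X ` {..<pos X v}"
  proof (intro equalityI subsetI)
    fix y assume y: "y \<in> {y \<in> set X. R y v}"
    have "pos X y < pos X v"
      using y assms * by (metis (no_types, lifting) linorder_neqE_nat mem_Collect_eq nth_pos pos_less_length)
    then show "y \<in> (!) X ` {..<pos X v}"
      using y by (auto intro!: image_eqI[of _ _ "pos X y"])
  next
    fix y assume "y \<in> (!) X ` {..<pos X v}"
    then obtain i where i: "i < pos X v" "y = X ! i" by auto
    moreover have "i < length X"
      using i(1) assms(3) by (metis order_less_trans pos_less_length)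
    ultimately show "y \<in> {y \<in> set X. R y v}"
      using *[of i "pos X v"] assms(3) by simp
  qed
  ultimately show ?thesis by (simp add: card_image)
qed

section \<open>Criteria for avoiding 321\<close>

lemma avoids_321_iff_pos:
  assumes "distinct xs"
  shows "avoids_321 xs \<longleftrightarrow>
    (\<forall>u\<in>set xs. \<forall>v\<in>set xs. \<forall>w\<in>set xs.
      pos xs u < pos xs v \<longrightarrow> pos xs v < pos xs w \<longrightarrow> \<not> (v < u \<and> w < v))"
    (is "?L \<longleftrightarrow> ?R")
proof
  assume ?L
  then show ?R
    unfolding avoids_321_def by (metis nth_pos pos_less_length)
next
  assume R: ?R
  show ?L
    unfolding avoids_321_def
  proof clarify
    fix a b c assume *: "a < b" "b < c" "c < length xs" "xs ! b < xs ! a" "xs ! c < xs ! b"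
    then show False
      using R[rule_format, of "xs ! a" "xs ! b" "xs ! c"] assms by (auto simp: pos_nth)
  qed
qed

lemma sorted_filter_iff_nth:
  "sorted (filter P ys) \<longleftrightarrow>
    (\<forall>j<length ys. \<forall>i<j. P (ys ! i) \<longrightarrow> P (ys ! j) \<longrightarrow> ys ! i \<le> ys ! j)"
proof (induction ys)
  case (Cons y ys)
  have "(\<forall>z\<in>set ys. P z \<longrightarrow> P y \<longrightarrow> y \<le> z) \<longleftrightarrow> (\<forall>j<length ys. P y \<longrightarrow> P (ys ! j) \<longrightarrow> y \<le> ys ! j)"
    by (auto simp: all_set_conv_all_nth)
  then show ?case
    using Cons by (simp add: All_less_Suc2) blast
qed simp

text \<open>A pattern that uses the new first entry \<open>x\<close> uses it as its largest entry,
  so what remains is a decreasing pair among the entries below \<open>x\<close>.\<close>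

lemma avoids_321_Cons:
  "avoids_321 (x # xs) \<longleftrightarrow> avoids_321 xs \<and> sorted (filter (\<lambda>y. y < x) xs)"
proof -
  \<comment> \<open>With nested bounded quantifiers, \<open>All_less_Suc2\<close> can peel off index
    0.\<close>
  have av: "avoids_321 p \<longleftrightarrow>
      (\<forall>c<length p. \<forall>b<c. \<forall>a<b. \<not> (p ! b < p ! a \<and> p ! c < p ! b))" for p
    unfolding avoids_321_def by blast
  have "avoids_321 (x # xs) \<longleftrightarrow>
      avoids_321 xs \<and> (\<forall>c<length xs. \<forall>b<c. \<not> (xs ! b < x \<and> xs ! c < xs ! b))"
    by (simp add: av All_less_Suc2) blast
  also have "(\<forall>c<length xs. \<forall>b<c. \<not> (xs ! b < x \<and> xs ! c < xs ! b)) \<longleftrightarrow>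
      sorted (filter (\<lambda>y. y < x) xs)"
    unfolding sorted_filter_iff_nth by (meson leD le_less_linear less_trans)
  finally show ?thesis .
qed

subsection \<open>Avoiders with one prescribed entry\<close>

text \<open>
  With \<open>X\<close> and \<open>Y\<close> both increasing this is the inverse permutation up to relabelling; with both
  decreasing it is the reverse complement of the inverse.
\<close>

definition inverse_word :: "'a list \<Rightarrow> 'b list \<Rightarrow> 'a list \<Rightarrow> 'b list" where
  "inverse_word X Y xs = map (\<lambda>x. Y ! pos xs x) X"

context
  fixes X :: "'a list" and Y :: "'b list" and xs :: "'a list"
  assumes XY: "distinct X" "distinct Y" "length X = length Y"
    and xs: "distinct xs" "set xs = set X"
begin

lemma length_xs: "length xs = length Y"
  using XY xs by (metis distinct_card)

lemma distinct_inverse_word: "distinct (inverse_word X Y xs)"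
proof -
  have "pos xs x < length Y" if "x \<in> set X" for x
    using that xs length_xs by (metis pos_less_length)
  then have "inj_on (\<lambda>x. Y ! pos xs x) (set X)"
    using XY xs by (auto simp: inj_on_def nth_eq_iff_index_eq pos_eq_iff)
  then show ?thesis
    using XY by (simp add: inverse_word_def distinct_map)
qed

lemma set_inverse_word: "set (inverse_word X Y xs) = set Y"
proof (rule card_subset_eq)
  show "set (inverse_word X Y xs) \<subseteq> set Y"
    using xs length_xs by (auto simp: inverse_word_def) (metis nth_mem pos_less_length)
  show "card (set (inverse_word X Y xs)) = card (set Y)"
    using distinct_inverse_word XY by (simp add: distinct_card) (simp add: inverse_word_def)
qed simp

text \<open>This is what makes exchanging \<open>X\<close> and \<open>Y\<close> undo the
  construction.\<close>

lemma pos_inverse_word: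
  assumes "k < length Y"
  shows "pos (inverse_word X Y xs) (Y ! k) = pos X (xs ! k)"
proof -
  have "xs ! k \<in> set X" using assms xs length_xs by (metis nth_mem)
  then have "pos X (xs ! k) < length X" by simp
  moreover have "inverse_word X Y xs ! pos X (xs ! k) = Y ! k"
    using \<open>xs ! k \<in> set X\<close> assms xs length_xs by (simp add: inverse_word_def pos_nth)
  ultimately show ?thesis
    using pos_nth[OF distinct_inverse_word, of "pos X (xs ! k)"] by (simp add: inverse_word_def)
qed

lemma inverse_word_inverse_word: "inverse_word Y X (inverse_word X Y xs) = xs"
proof (rule nth_equalityI)
  show len: "length (inverse_word Y X (inverse_word X Y xs)) = length xs"
    by (simp add: inverse_word_def length_xs)
  fix k assume "k < length (inverse_word Y X (inverse_word X Y xs))"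
  then have k: "k < length Y" by (simp add: inverse_word_def)
  then have "xs ! k \<in> set X" using xs length_xs by (metis nth_mem)
  then show "inverse_word Y X (inverse_word X Y xs) ! k = xs ! k"
    using k pos_inverse_word[OF k] by (simp add: inverse_word_def[of Y])
qed

end

text \<open>The pattern 321 is its own inverse and is fixed by reverse complement. A pattern in the
  new word yields one in \<open>xs\<close>, with the three entries in reversed order if both lists
  increase and in the same order if both decrease.\<close>

lemma avoids_321_inverse_word:
  fixes X Y :: "nat list"
  assumes "sorted_wrt (<) X \<and> sorted_wrt (<) Y \<or> sorted_wrt (>) X \<and> sorted_wrt (>) Y"
    and len: "length X = length Y" and "distinct xs" "set xs = set X" and av: "avoids_321 xs"
  shows "avoids_321 (inverse_word X Y xs)"
  unfolding avoids_321_def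
proof clarify
  fix a b c
  assume *: "a < b" "b < c" "c < length (inverse_word X Y xs)"
    "inverse_word X Y xs ! b < inverse_word X Y xs ! a"
    "inverse_word X Y xs ! c < inverse_word X Y xs ! b"
  then have c: "c < length X" by (simp add: inverse_word_def)
  have mem: "X ! a \<in> set xs" "X ! b \<in> set xs" "X ! c \<in> set xs"
    using * c assms by auto
  have dX: "distinct X"
    using assms(1) by (auto simp: sorted_wrt_iff_nth_less distinct_conv_nth) (metis linorder_neqE_nat less_irrefl)+
  have "length xs = length Y"
    using len dX assms(3,4) by (metis distinct_card)
  then have lt: "pos xs (X ! a) < length Y" "pos xs (X ! b) < length Y" "pos xs (X ! c) < length Y"
    using mem by (metis pos_less_length)+
  have Y: "Y ! pos xs (X ! b) < Y ! pos xs (X ! a)" "Y ! pos xs (X ! c) < Y ! pos xs (X ! b)"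
    using * c by (simp_all add: inverse_word_def)
  note av' = av[unfolded avoids_321_iff_pos[OF assms(3)], rule_format]
  from assms(1) show False
  proof
    assume s: "sorted_wrt (<) X \<and> sorted_wrt (<) Y"
    have "i > j" if "Y ! j < Y ! i" "j < length Y" for i j
      using s that by (metis linorder_neqE_nat order_less_asym sorted_wrt_iff_nth_less)
    then have "pos xs (X ! b) < pos xs (X ! a)" "pos xs (X ! c) < pos xs (X ! b)"
      using Y lt by auto
    moreover have "X ! a < X ! b" "X ! b < X ! c"
      using s * c by (auto simp: sorted_wrt_iff_nth_less)
    ultimately show False using av'[of "X ! c" "X ! b" "X ! a"] mem by auto
  next
    assume s: "sorted_wrt (>) X \<and> sorted_wrt (>) Y"
    have "i < j" if "Y ! j < Y ! i" "i < length Y" for i j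
      using s that by (metis linorder_neqE_nat order_less_asym sorted_wrt_iff_nth_less)
    then have "pos xs (X ! b) > pos xs (X ! a)" "pos xs (X ! c) > pos xs (X ! b)"
      using Y lt by auto
    moreover have "X ! a > X ! b" "X ! b > X ! c"
      using s * c by (auto simp: sorted_wrt_iff_nth_less)
    ultimately show False using av'[of "X ! a" "X ! b" "X ! c"] mem by auto
  qed
qed

text \<open>Inversion exchanges entries and positions: \<open>X ! l\<close> at index
  \<open>e\<close> becomes the maximum \<open>Y ! e\<close> at index \<open>l\<close>. The argument
  is \<open>Suc l\<close> because \<open>b_num\<close> counts positions from 1.\<close>

lemma card_avoiders_nth:
  assumes mono: "sorted_wrt (<) X \<and> sorted_wrt (<) Y \<or> sorted_wrt (>) X \<and> sorted_wrt (>) Y"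
    and len: "length X = N" and Y: "set Y = {1..N}" "e < N" "Y ! e = N" and l: "l < N"
  shows "card {xs \<in> permutations_of_set (set X). avoids_321 xs \<and> xs ! e = X ! l} = b_num N (Suc l)"
proof -
  have d: "distinct X" "distinct Y"
    using mono by (auto simp: sorted_wrt_iff_nth_less distinct_conv_nth) (metis linorder_neqE_nat less_irrefl)+
  have lY: "length X = length Y"
    using len d Y by (metis card_atLeastAtMost diff_Suc_1 distinct_card)
  have mono': "sorted_wrt (<) Y \<and> sorted_wrt (<) X \<or> sorted_wrt (>) Y \<and> sorted_wrt (>) X"
    using mono by auto
  have "bij_betw (inverse_word X Y)
     {xs \<in> permutations_of_set (set X). avoids_321 xs \<and> xs ! e = X ! l}
     {r \<in> perms N. avoids_321 r \<and> r ! (Suc l - 1) = N}"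
  proof (rule bij_betw_byWitness[where f' = "inverse_word Y X"])
    show "\<forall>xs\<in>{xs \<in> permutations_of_set (set X). avoids_321 xs \<and> xs ! e = X ! l}.
        inverse_word Y X (inverse_word X Y xs) = xs"
      using inverse_word_inverse_word[OF d lY] by (auto simp: permutations_of_set_def)
    show "\<forall>r\<in>{r \<in> perms N. avoids_321 r \<and> r ! (Suc l - 1) = N}.
        inverse_word X Y (inverse_word Y X r) = r"
      using inverse_word_inverse_word[OF d(2,1) lY[symmetric]] Y
      by (auto simp: permutations_of_set_def perms_def)
    show "inverse_word X Y ` {xs \<in> permutations_of_set (set X). avoids_321 xs \<and> xs ! e = X ! l}
        \<subseteq> {r \<in> perms N. avoids_321 r \<and> r ! (Suc l - 1) = N}"
    proof (rule image_subsetI)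
      fix xs assume "xs \<in> {xs \<in> permutations_of_set (set X). avoids_321 xs \<and> xs ! e = X ! l}"
      then have xs: "xs \<in> permutations_of_set (set X)" "avoids_321 xs" "xs ! e = X ! l" by auto
      then have ds: "distinct xs" "set xs = set X" by (auto simp: permutations_of_set_def)
      have "length xs = N" using length_xs[OF d lY ds] lY len by simp
      then have "pos xs (X ! l) = e"
        using xs(3) pos_nth[OF ds(1), of e] Y by simp
      then show "inverse_word X Y xs \<in> {r \<in> perms N. avoids_321 r \<and> r ! (Suc l - 1) = N}"
        using distinct_inverse_word[OF d lY ds] set_inverse_word[OF d lY ds] Y l len
          avoids_321_inverse_word[OF mono lY ds xs(2)]
        by (simp add: perms_def permutations_of_set_def inverse_word_def)
    qed
    show "inverse_word Y X ` {r \<in> perms N. avoids_321 r \<and> r ! (Suc l - 1) = N}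
        \<subseteq> {xs \<in> permutations_of_set (set X). avoids_321 xs \<and> xs ! e = X ! l}"
    proof (rule image_subsetI)
      fix r assume "r \<in> {r \<in> perms N. avoids_321 r \<and> r ! (Suc l - 1) = N}"
      then have r: "r \<in> perms N" "avoids_321 r" "r ! (Suc l - 1) = N" by auto
      then have ds: "distinct r" "set r = set Y" using Y by (auto simp: permutations_of_set_def perms_def)
      have "length r = N" using length_xs[OF d(2,1) lY[symmetric] ds] lY len by simp
      then have "pos r N = l"
        using r(3) pos_nth[OF ds(1), of l] l by simp
      then show "inverse_word Y X r \<in> {xs \<in> permutations_of_set (set X). avoids_321 xs \<and> xs ! e = X ! l}"
        using distinct_inverse_word[OF d(2,1) lY[symmetric] ds]
          set_inverse_word[OF d(2,1) lY[symmetric] ds] Y l len lY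
          avoids_321_inverse_word[OF mono' lY[symmetric] ds r(2)]
        by (simp add: permutations_of_set_def inverse_word_def)
    qed
  qed
  then show ?thesis unfolding b_num_def by (rule bij_betw_same_card)
qed

text \<open>In an increasing \<open>Y\<close> the maximum comes last, so a prescribed last entry
  becomes, after inversion, a prescribed position of the maximum.\<close>

lemma card_avoiders_last:
  assumes "finite X" "v \<in> X"
  shows "card {xs \<in> permutations_of_set X. avoids_321 xs \<and> last xs = v}
    = b_num (card X) (card {y \<in> X. y \<le> v})"
proof -
  define L where "L = sorted_list_of_set X"
  have L: "sorted_wrt (<) L" "set L = X" "length L = card X"
    using assms by (auto simp: L_def)
  have N: "0 < card X" using assms card_gt_0_iff by blast
  have "{y \<in> X. y \<le> v} = insert v {y \<in> X. y < v}" using assms by auto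
  then have c: "card {y \<in> X. y \<le> v} = Suc (pos L v)"
    using pos_sorted_wrt[OF L(1)] L(2) assms by simp
  have "last xs = xs ! (card X - 1)" if "xs \<in> permutations_of_set X" for xs
    using that assms
    by (metis last_conv_nth length_finite_permutations_of_set permutations_of_setD(1) emptyE set_empty)
  then have "{xs \<in> permutations_of_set X. avoids_321 xs \<and> last xs = v} =
     {xs \<in> permutations_of_set (set L). avoids_321 xs \<and> xs ! (card X - 1) = L ! pos L v}"
    using L assms by auto
  also have "card \<dots> = b_num (card X) (Suc (pos L v))"
  proof (rule card_avoiders_nth[where Y = "[1..<Suc (card X)]"])
    show "sorted_wrt (<) L \<and> sorted_wrt (<) [1..<Suc (card X)] \<or>
        sorted_wrt (>) L \<and> sorted_wrt (>) [1..<Suc (card X)]"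
      using L(1) by (intro disjI1 conjI sorted_wrt_upt)
    show "pos L v < card X" using L assms by (metis pos_less_length)
    show "[1..<Suc (card X)] ! (card X - 1) = card X"
      using N by (simp del: upt_Suc)
  qed (use L N in auto)
  finally show ?thesis using c by simp
qed

text \<open>In a decreasing \<open>Y\<close> the maximum comes first, so now the first entry can be
  prescribed; its rank is counted from above.\<close>

lemma card_avoiders_hd:
  assumes "finite X" "v \<in> X"
  shows "card {xs \<in> permutations_of_set X. avoids_321 xs \<and> hd xs = v}
    = b_num (card X) (card {y \<in> X. v \<le> y})"
proof -
  define L where "L = rev (sorted_list_of_set X)"
  have L: "sorted_wrt (>) L" "set L = X" "length L = card X"
    using assms by (auto simp: L_def sorted_wrt_rev)
  have N: "0 < card X" using assms card_gt_0_iff by blast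
  have "{y \<in> X. v \<le> y} = insert v {y \<in> X. v < y}" using assms by auto
  then have c: "card {y \<in> X. v \<le> y} = Suc (pos L v)"
    using pos_sorted_wrt[OF L(1)] L(2) assms by simp
  have "hd xs = xs ! 0" if "xs \<in> permutations_of_set X" for xs
    using that assms by (metis hd_conv_nth permutations_of_setD(1) emptyE set_empty)
  then have "{xs \<in> permutations_of_set X. avoids_321 xs \<and> hd xs = v} =
     {xs \<in> permutations_of_set (set L). avoids_321 xs \<and> xs ! 0 = L ! pos L v}"
    using L assms by auto
  also have "card \<dots> = b_num (card X) (Suc (pos L v))"
  proof (rule card_avoiders_nth[where Y = "rev [1..<Suc (card X)]"])
    show "sorted_wrt (<) L \<and> sorted_wrt (<) (rev [1..<Suc (card X)]) \<or>
        sorted_wrt (>) L \<and> sorted_wrt (>) (rev [1..<Suc (card X)])"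
      using L(1) by (simp add: sorted_wrt_rev sorted_wrt_upt del: upt_Suc)
    show "pos L v < card X" using L assms by (metis pos_less_length)
    show "rev [1..<Suc (card X)] ! 0 = card X"
      using N by (simp add: rev_nth del: upt_Suc)
  qed (use L N in auto)
  finally show ?thesis using c by simp
qed

subsection \<open>Queuesort as a queue with bypass\<close>

text \<open>The threshold \<open>t\<close> stands for the largest entry already read. It turns the
  left-to-right maxima into a structural recursion that runs in step with
  \<open>bypass\<close>.\<close>

fun maxima_above :: "nat \<Rightarrow> nat list \<Rightarrow> nat list" where
  "maxima_above t [] = []"
| "maxima_above t (x # xs) = (if t < x then x # maxima_above x xs else maxima_above t xs)"

text \<open>
  Left-to-right recursion for Queuesort: \<open>t\<close> is the largest entry read so far, hence
  the last one in the queue.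
\<close>

fun bypass :: "nat \<Rightarrow> nat list \<Rightarrow> nat list" where
  "bypass t [] = []"
| "bypass t (x # xs) = (if t < x then push_right x (bypass x xs) else x # bypass t xs)"

lemma is_ltr_max_Cons_Suc: "is_ltr_max (x # xs) (Suc i) \<longleftrightarrow> is_ltr_max xs i \<and> x < xs ! i"
  by (auto simp: is_ltr_max_def less_Suc_eq_0_disj)

lemma maxima_above_eq:
  "maxima_above t xs =
    map ((!) xs) (filter (\<lambda>i. is_ltr_max xs i \<and> t < xs ! i) [0..<length xs])"
proof (induction xs arbitrary: t)
  case (Cons x xs)
  have "[0..<length (x # xs)] = 0 # map Suc [0..<length xs]"
    by (simp add: map_Suc_upt upt_conv_Cons del: upt_Suc)
  moreover have "is_ltr_max (x # xs) 0" by (simp add: is_ltr_max_def)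
  moreover have "t < x \<Longrightarrow> (is_ltr_max xs i \<and> x < xs ! i) \<and> t < xs ! i \<longleftrightarrow> is_ltr_max xs i \<and> x < xs ! i"
     "\<not> t < x \<Longrightarrow> (is_ltr_max xs i \<and> x < xs ! i) \<and> t < xs ! i \<longleftrightarrow> is_ltr_max xs i \<and> t < xs ! i" for i
    by auto
  ultimately show ?case
    using Cons by (simp add: filter_map o_def is_ltr_max_Cons_Suc del: upt_Suc)
qed simp

lemma ltr_maxima_eq:
  assumes "0 \<notin> set xs"
  shows "ltr_maxima xs = maxima_above 0 xs"
proof -
  \<comment> \<open>All entries are positive, so the threshold 0 discards nothing.\<close>
  have "is_ltr_max xs i \<longleftrightarrow> is_ltr_max xs i \<and> 0 < xs ! i" for i
    using assms by (auto simp: is_ltr_max_def) (metis gr0I nth_mem)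
  then show ?thesis unfolding ltr_maxima_def maxima_above_eq by metis
qed

lemma maxima_above_gt: "m \<in> set (maxima_above t xs) \<Longrightarrow> t < m"
  by (induction xs arbitrary: t) (auto split: if_splits intro: order_less_trans)

lemma foldr_bubble_Cons: "x \<notin> set ms \<Longrightarrow> foldr bubble ms (x # xs) = x # foldr bubble ms xs"
  by (induction ms) (auto simp: bubble_def)

text \<open>If the head is a maximum, \<open>foldr\<close> moves it only after the whole tail has
  been treated with the head as threshold. Otherwise the head stays in front, as every moved entry
  starts behind it.\<close>

lemma foldr_bubble_maxima: "foldr bubble (maxima_above t xs) xs = bypass t xs"
proof (induction xs arbitrary: t)
  case (Cons x xs)
  have "x \<notin> set (maxima_above x xs)" "\<not> t < x \<Longrightarrow> x \<notin> set (maxima_above t xs)"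
    using maxima_above_gt by blast+
  with Cons show ?case by (auto simp: foldr_bubble_Cons) (simp add: bubble_def)
qed simp

lemma queuesort_eq_bypass: "0 \<notin> set xs \<Longrightarrow> queuesort xs = bypass 0 xs"
  by (simp add: queuesort_def ltr_maxima_eq foldr_bubble_maxima)

section \<open>Positions before and after \<open>bypass\<close>\<close>

lemma set_bypass [simp]: "set (bypass t xs) = set xs"
proof (induction xs arbitrary: t)
  case (Cons x xs)
  have "set (push_right x zs) = insert x (set zs)" for zs
    by (induction zs) auto
  with Cons show ?case by simp
qed simp

lemma maxima_above_subset: "set (maxima_above t xs) \<subseteq> set xs"
  by (induction xs arbitrary: t) (auto split: if_splits)

lemma maxima_above_iff:
  assumes "distinct xs"
  shows "m \<in> set (maxima_above t xs) \<longleftrightarrow>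
    m \<in> set xs \<and> t < m \<and> (\<forall>w\<in>set xs. pos xs w < pos xs m \<longrightarrow> w < m)"
  using assms
proof (induction xs arbitrary: t)
  case (Cons x xs)
  show ?case
  proof (cases "m = x")
    case True
    then show ?thesis using Cons.prems maxima_above_subset[of t xs] by auto
  next
    case False
    have "pos (x # xs) w = Suc (pos xs w)" if "w \<in> set xs" for w
      using that Cons.prems by auto
    then have *: "(\<forall>w\<in>set (x # xs). pos (x # xs) w < pos (x # xs) m \<longrightarrow> w < m) \<longleftrightarrow>
        x < m \<and> (\<forall>w\<in>set xs. pos xs w < pos xs m \<longrightarrow> w < m)"
      using False by (simp del: pos_Cons) simp
    have IH: "m \<in> set (maxima_above t xs) \<longleftrightarrow>
        m \<in> set xs \<and> t < m \<and> (\<forall>w\<in>set xs. pos xs w < pos xs m \<longrightarrow> w < m)" for t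
      using Cons by simp
    show ?thesis
      unfolding * using False IH by (cases "t < x") auto
  qed
qed simp

text \<open>The entry \<open>x\<close> lands at index \<open>k\<close>, directly before the first
  larger entry or at the end. The five facts express this by positions, so that the inductions below
  need not look inside \<open>push_right\<close>.\<close>

lemma pos_push_right:
  assumes "x \<notin> set zs"
  obtains k where "pos (push_right x zs) x = k"
    and "\<And>u. u \<in> set zs \<Longrightarrow>
      pos (push_right x zs) u = (if pos zs u < k then pos zs u else Suc (pos zs u))"
    and "\<And>u. u \<in> set zs \<Longrightarrow> pos zs u < k \<Longrightarrow> u < x"
    and "\<And>u. u \<in> set zs \<Longrightarrow> pos zs u = k \<Longrightarrow> x < u"
    and "\<And>u. u \<in> set zs \<Longrightarrow> (\<forall>v\<in>set zs. pos zs v \<le> pos zs u \<longrightarrow> v \<le> x) \<Longrightarrow> pos zs u < k"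
proof -
  let ?k = "pos (push_right x zs) x"
  have 1: "pos (push_right x zs) u = (if pos zs u < ?k then pos zs u else Suc (pos zs u))"
    if "u \<in> set zs" for u
  proof -
    have "x \<noteq> u" using assms that by blast
    with that show ?thesis by (induction zs) (simp_all, force)
  qed
  have 2: "u < x" if "u \<in> set zs" "pos zs u < ?k" for u
    using assms that by (induction zs) (simp_all split: if_splits)
  have 3: "x < u" if "u \<in> set zs" "pos zs u = ?k" for u
    using assms that by (induction zs) (simp_all split: if_splits)
  \<comment> \<open>A disjunctive form of the fifth fact, suited to induction: either a larger entry
    blocks \<open>x\<close> no later than at \<open>u\<close>, or \<open>x\<close> passes
    \<open>u\<close>.\<close>
  have 4: "(\<exists>v\<in>set zs. pos zs v \<le> pos zs u \<and> x < v) \<or> pos zs u < ?k"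
    if "u \<in> set zs" for u
    using assms that
  proof (induction zs)
    case (Cons z zs)
    show ?case
    proof (cases "z < x \<and> z \<noteq> u")
      case True
      then have "(\<exists>v\<in>set zs. pos zs v \<le> pos zs u \<and> x < v) \<or>
          pos zs u < pos (push_right x zs) x"
        using Cons by simp
      then show ?thesis
      proof (elim disjE bexE)
        fix v assume "v \<in> set zs" "pos zs v \<le> pos zs u \<and> x < v"
        then show ?thesis using True by (intro disjI1 bexI[of _ v]) simp_all
      qed (use True in simp)
    next
      case False
      show ?thesis
      proof (cases "z < x")
        case True
        with False show ?thesis by simp
      next
        case False
        with Cons.prems(1) have "x < z" by simp
        then show ?thesis by (intro disjI1 bexI[of _ z]) simp_all
      qed
    qed
  qed simp
  have 5: "pos zs u < ?k"
    if "u \<in> set zs" "\<forall>v\<in>set zs. pos zs v \<le> pos zs u \<longrightarrow> v \<le> x" for u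
    using 4[OF that(1)] that(2) leD by blast
  show ?thesis by (rule that[OF refl 1 2 3 5])
qed

text \<open>A push keeps the relative order of all other entries, and \<open>x\<close> passes only
  later entries that are smaller, hence not maxima.\<close>

lemma bypass_inversion:
  assumes "distinct s" "u \<in> set s" "v \<in> set s" "pos s u < pos s v"
    and "pos (bypass t s) v < pos (bypass t s) u"
  shows "u \<in> set (maxima_above t s) \<and> v \<notin> set (maxima_above t s)"
  using assms
proof (induction s arbitrary: t)
  case (Cons x s)
  show ?case
  proof (cases "t < x")
    case True
    have "x \<notin> set (bypass x s)" using Cons.prems by simp
    then obtain k where k: "pos (push_right x (bypass x s)) x = k"
      "\<And>u. u \<in> set s \<Longrightarrow> pos (push_right x (bypass x s)) u =
        (if pos (bypass x s) u < k then pos (bypass x s) u else Suc (pos (bypass x s) u))"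
      "\<And>u. u \<in> set s \<Longrightarrow> pos (bypass x s) u < k \<Longrightarrow> u < x"
      by (rule pos_push_right) simp
    have v: "v \<noteq> x" "v \<in> set s" using Cons.prems by auto
    show ?thesis
    proof (cases "u = x")
      case u: True
      have "v < x" using k v Cons.prems(5) True u by (auto split: if_splits)
      then show ?thesis using u v True maxima_above_gt[of v x s] by auto
    next
      case False
      then have "pos (bypass x s) v < pos (bypass x s) u"
        using k v Cons.prems True by (auto split: if_splits)
      then show ?thesis using Cons.IH[of x] Cons.prems False v True by auto
    qed
  next
    case False
    then show ?thesis using Cons.IH[of t] Cons.prems by (auto split: if_splits)
  qed
qed simp

text \<open>The second alternative covers a \<open>b\<close> not overtaken by any maximum of
  \<open>s\<close>: a larger \<open>t\<close> pushed through the output afterwards would still pass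
  \<open>b\<close>. For \<open>t = 0\<close> and positive entries it is impossible, so then some
  maximum does overtake \<open>b\<close>.\<close>

lemma bypass_overtaken:
  assumes "distinct s" "b \<in> set s" "b \<notin> set (maxima_above t s)"
  shows "(\<exists>q\<in>set (maxima_above t s). pos s q < pos s b \<and> pos (bypass t s) b < pos (bypass t s) q) \<or>
    (\<forall>u\<in>set s. pos (bypass t s) u \<le> pos (bypass t s) b \<longrightarrow> u \<le> t)"
  using assms
proof (induction s arbitrary: t)
  case (Cons x s)
  show ?case
  proof (cases "t < x")
    case True
    have "x \<notin> set (bypass x s)" using Cons.prems by simp
    then obtain k where k: "pos (push_right x (bypass x s)) x = k"
      "\<And>u. u \<in> set s \<Longrightarrow> pos (push_right x (bypass x s)) u =
        (if pos (bypass x s) u < k then pos (bypass x s) u else Suc (pos (bypass x s) u))"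
      "\<And>u. u \<in> set s \<Longrightarrow> (\<forall>v\<in>set s. pos (bypass x s) v \<le> pos (bypass x s) u \<longrightarrow> v \<le> x)
         \<Longrightarrow> pos (bypass x s) u < k"
      by (rule pos_push_right) simp
    have b: "b \<noteq> x" "b \<in> set s" "b \<notin> set (maxima_above x s)" using Cons.prems True by auto
    have "(\<exists>q\<in>set (maxima_above x s). pos s q < pos s b \<and> pos (bypass x s) b < pos (bypass x s) q) \<or>
      (\<forall>u\<in>set s. pos (bypass x s) u \<le> pos (bypass x s) b \<longrightarrow> u \<le> x)"
      using Cons.IH[of x] Cons.prems(1) b by simp
    \<comment> \<open>Here the first alternative always results: if the second one holds for the
      threshold \<open>x\<close>, then \<open>x\<close> itself passes \<open>b\<close>.\<close>
    then have "\<exists>q\<in>set (maxima_above t (x # s)). pos (x # s) q < pos (x # s) b \<and>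
      pos (bypass t (x # s)) b < pos (bypass t (x # s)) q"
    proof (elim disjE bexE)
      fix q assume q: "q \<in> set (maxima_above x s)"
        "pos s q < pos s b \<and> pos (bypass x s) b < pos (bypass x s) q"
      then have "q \<in> set s" "q \<noteq> x" using maxima_above_subset Cons.prems(1) by auto
      then show ?thesis using q b k True by (intro bexI[of _ q]) auto
    next
      assume "\<forall>u\<in>set s. pos (bypass x s) u \<le> pos (bypass x s) b \<longrightarrow> u \<le> x"
      then have "pos (bypass x s) b < k" using k(3) b by blast
      then show ?thesis using b k True by (intro bexI[of _ x]) auto
    qed
    then show ?thesis ..
  next
    case False
    show ?thesis
    proof (cases "b = x")
      case True
      \<comment> \<open>Now \<open>b\<close> heads the output and does not exceed \<open>t\<close>,
        which is the second alternative.\<close>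
      then show ?thesis using False Cons.prems by auto
    next
      case b: False
      have "(\<exists>q\<in>set (maxima_above t s). pos s q < pos s b \<and> pos (bypass t s) b < pos (bypass t s) q) \<or>
        (\<forall>u\<in>set s. pos (bypass t s) u \<le> pos (bypass t s) b \<longrightarrow> u \<le> t)"
        using Cons.IH[of t] Cons.prems b False by simp
      then show ?thesis
      proof (elim disjE bexE)
        fix q assume q: "q \<in> set (maxima_above t s)"
          "pos s q < pos s b \<and> pos (bypass t s) b < pos (bypass t s) q"
        then have "q \<in> set s" "q \<noteq> x" using maxima_above_subset Cons.prems(1) by auto
        then show ?thesis using q b False by (intro disjI1 bexI[of _ q]) auto
      next
        assume "\<forall>u\<in>set s. pos (bypass t s) u \<le> pos (bypass t s) b \<longrightarrow> u \<le> t"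
        then show ?thesis using b False by (intro disjI2) simp
      qed
    qed
  qed
qed simp

text \<open>A pushed maximum stops directly before the first larger entry, so everything before it
  is smaller. The pushes that follow move smaller entries, which stop in front of it and never come
  between it and its successor.\<close>

lemma bypass_maxima:
  assumes "distinct s" "q \<in> set (maxima_above t s)" "u \<in> set s"
  shows "pos (bypass t s) u < pos (bypass t s) q \<Longrightarrow> u < q"
    and "pos (bypass t s) u = Suc (pos (bypass t s) q) \<Longrightarrow> q < u"
proof -
  have "(pos (bypass t s) u < pos (bypass t s) q \<longrightarrow> u < q) \<and>
    (pos (bypass t s) u = Suc (pos (bypass t s) q) \<longrightarrow> q < u)"
    using assms
  proof (induction s arbitrary: t)
    case (Cons x s)
    show ?case
    proof (cases "t < x")
      case True
      have "x \<notin> set (bypass x s)" using Cons.prems by simp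
      then obtain k where k: "pos (push_right x (bypass x s)) x = k"
        "\<And>u. u \<in> set s \<Longrightarrow> pos (push_right x (bypass x s)) u =
          (if pos (bypass x s) u < k then pos (bypass x s) u else Suc (pos (bypass x s) u))"
        "\<And>u. u \<in> set s \<Longrightarrow> pos (bypass x s) u < k \<Longrightarrow> u < x"
        "\<And>u. u \<in> set s \<Longrightarrow> pos (bypass x s) u = k \<Longrightarrow> x < u"
        by (rule pos_push_right) simp
      show ?thesis
      proof (cases "q = x")
        case q: True
        show ?thesis
        proof (cases "u = x")
          case False
          then have "u \<in> set s" using Cons.prems(3) by simp
          with k(1) k(2-4)[of u] show ?thesis
            unfolding q bypass.simps if_P[OF True] by (simp split: if_splits)
        qed (use q in simp)
      next
        case False
        then have q: "q \<in> set (maxima_above x s)" "x < q" "q \<in> set s"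
          using Cons.prems True maxima_above_gt[of q x s] maxima_above_subset[of x s] by auto
        then have "\<not> pos (bypass x s) q < k" using k(3)[of q] by auto
        then have pq: "pos (bypass t (x # s)) q = Suc (pos (bypass x s) q)" "k \<le> pos (bypass x s) q"
          using k(2)[of q] q True by simp_all
        show ?thesis
        proof (cases "u = x")
          case u: True
          then show ?thesis using pq q True k(1) by simp
        next
          case False
          then have u: "u \<in> set s" using Cons.prems(3) by simp
          have "distinct s" using Cons.prems(1) by simp
          note Cons.IH[OF this q(1) u]
          moreover have "pos (bypass t (x # s)) u =
              (if pos (bypass x s) u < k then pos (bypass x s) u else Suc (pos (bypass x s) u))"
            using k(2)[OF u] True by simp
          ultimately show ?thesis unfolding pq using pq(2) by (simp split: if_splits)
        qed
      qed
    next
      case False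
      then have "q \<noteq> x" using Cons.prems maxima_above_gt[of q t s] by auto
      then show ?thesis using Cons.IH[of t] Cons.prems False maxima_above_gt[of q t s]
        by (cases "u = x") simp_all
    qed
  qed simp
  then show "pos (bypass t s) u < pos (bypass t s) q \<Longrightarrow> u < q"
    and "pos (bypass t s) u = Suc (pos (bypass t s) q) \<Longrightarrow> q < u" by auto
qed

section \<open>Recovering a preimage from an avoider\<close>

lemma push_right_map_insort:
  assumes "sorted ys" "x \<notin> set ys" "\<And>y. y < x \<Longrightarrow> f y < f x"
    and "Suc x \<in> set ys \<and> f x < f (Suc x) \<or> (\<forall>y\<in>set ys. y < x)"
  shows "push_right (f x) (map f ys) = map f (insort x ys)"
  using assms
proof (induction ys)
  case (Cons y ys)
  show ?case
  proof (cases "y < x")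
    case True
    then show ?thesis using Cons by auto
  next
    case False
    \<comment> \<open>As \<open>Suc x\<close> lies in the sorted list, the first entry not below
      \<open>x\<close> can only be \<open>Suc x\<close>; the push stops there.\<close>
    then have "y = Suc x" "f x < f (Suc x)" using Cons.prems by auto
    then show ?thesis by simp
  qed
qed simp

text \<open>Here \<open>f\<close> turns target positions into entries, and \<open>T\<close> is the
  largest position read so far. All positions above \<open>T\<close> are still to come, so a pushed
  \<open>x\<close> below \<open>n\<close> finds \<open>Suc x\<close> to stop it. Avoidance lets the
  non-maxima appear in increasing order. The conditions on \<open>f\<close> make maxima of
  \<open>r\<close> maxima of its image and stop each push at the right place.\<close>

lemma bypass_avoider:
  assumes "distinct r" "set r \<subseteq> {..n}" "{T<..n} \<subseteq> set r" "T \<notin> set r" "avoids_321 (T # r)"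
    and "\<And>k y. k \<in> insert T (set (maxima_above T r)) \<Longrightarrow> y < k \<Longrightarrow> f y < f k"
    and "\<And>k. k \<in> insert T (set (maxima_above T r)) \<Longrightarrow> k < n \<Longrightarrow> f k < f (Suc k)"
  shows "bypass (f T) (map f r) = map f (sort r)"
  using assms
proof (induction r arbitrary: T)
  case (Cons x xs)
  show ?case
  proof (cases "T < x")
    case True
    have IH: "bypass (f x) (map f xs) = map f (sort xs)"
    proof (rule Cons.IH)
      show "{x<..n} \<subseteq> set xs"
      proof
        fix y assume "y \<in> {x<..n}"
        then show "y \<in> set xs" using subsetD[OF Cons.prems(3), of y] True by simp
      qed
      show "avoids_321 (x # xs)" using Cons.prems(5) avoids_321_Cons by blast
    qed (use Cons.prems True in auto)
    have "Suc x \<in> set xs \<and> f x < f (Suc x) \<or> (\<forall>y\<in>set xs. y < x)"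
    proof (cases "x < n")
      case True
      then have "Suc x \<in> set (x # xs)" using Cons.prems(3) \<open>T < x\<close> by (intro subsetD[OF Cons.prems(3)]) auto
      then show ?thesis using Cons.prems(7)[of x] True \<open>T < x\<close> by auto
    next
      case False
      have "y < x" if "y \<in> set xs" for y
      proof -
        have "y \<noteq> x" "y \<le> n" using that Cons.prems(1,2) by auto
        then show ?thesis using False by simp
      qed
      then show ?thesis by blast
    qed
    then have "push_right (f x) (map f (sort xs)) = map f (insort x (sort xs))"
      using Cons.prems True by (intro push_right_map_insort) auto
    then show ?thesis using IH Cons.prems(6)[of x T] True by simp
  next
    case False
    then have "x < T" using Cons.prems by auto
    have av: "avoids_321 xs" "sorted (filter (\<lambda>y. y < T) xs)" "\<And>y. y \<in> set xs \<Longrightarrow> y < T \<Longrightarrow> x \<le> y"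
      using Cons.prems(5) \<open>x < T\<close> by (auto simp: avoids_321_Cons)
    have "bypass (f T) (map f xs) = map f (sort xs)"
    proof (rule Cons.IH)
      show "{T<..n} \<subseteq> set xs"
      proof
        fix y assume "y \<in> {T<..n}"
        then show "y \<in> set xs" using subsetD[OF Cons.prems(3), of y] \<open>x < T\<close> by simp
      qed
      show "avoids_321 (T # xs)" using av avoids_321_Cons by blast
    qed (use Cons.prems False in auto)
    \<comment> \<open>By avoidance \<open>x\<close> is at most every later entry below
      \<open>T\<close>, hence it is the minimum of what remains.\<close>
    moreover have "insort x (sort xs) = x # sort xs"
      using av(3) \<open>x < T\<close> by (intro insort_is_Cons) force
    ultimately show ?thesis using Cons.prems(6)[of T x] \<open>x < T\<close> by simp
  qed
qed simp

subsection \<open>Preimages as avoiders\<close>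

text \<open>The bijection replaces positions in \<open>p\<close> by entries of \<open>p\<close>. A
  maximum \<open>k\<close> of \<open>r\<close> stands for the entry of \<open>p\<close> at index
  \<open>k - 1\<close>, and \<open>k\<close> is the index of its right neighbour, if there is
  one.\<close>

lemma card_queuesort_preimage:
  assumes p: "p \<in> perms n"
  shows "card (queuesort_preimage n p) =
    card {r \<in> perms n. avoids_321 r \<and>
      (\<forall>k\<in>set (maxima_above 0 r). is_ltr_max p (k - 1) \<and> (k < n \<longrightarrow> is_ltr_max p k))}"
    (is "_ = card ?R")
proof -
  \<comment> \<open>The extra 0 makes positions count from 1 and gives \<open>f 0 = 0\<close>, the
    threshold with which \<open>bypass\<close> starts.\<close>
  define f where "f = (\<lambda>k. (0 # p) ! k)"
  define g where "g = (\<lambda>x. Suc (pos p x))"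
  have dp: "distinct p" "set p = {1..n}"
    using p by (auto simp: perms_def permutations_of_set_def)
  have lp: "length p = n"
    using dp by (metis card_atLeastAtMost diff_Suc_1 distinct_card)
  have f_Suc: "f (Suc k) = p ! k" and f0: "f 0 = 0" for k by (simp_all add: f_def)
  have fg: "f (g x) = x" if "x \<in> {1..n}" for x
    using that dp by (simp add: g_def f_Suc)
  have gf: "g (f k) = k" if "k \<in> {1..n}" for k
    using that dp lp by (cases k) (simp_all add: g_def f_Suc pos_nth)
  have f_in: "f k \<in> {1..n}" if "k \<in> {1..n}" for k
    using that dp lp by (cases k) (auto simp: f_Suc dest: nth_mem)
  have g_in: "g x \<in> {1..n}" if "x \<in> {1..n}" for x
    using that dp lp pos_less_length[of p x] by (auto simp: g_def Suc_le_eq simp del: pos_less_length)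
  have bf: "bij_betw f {1..n} {1..n}"
    by (rule bij_betw_byWitness[where f' = g]) (use fg gf f_in g_in in blast)+
  have bg: "bij_betw g {1..n} {1..n}"
    by (rule bij_betw_byWitness[where f' = f]) (use fg gf f_in g_in in blast)+
  have perms_map: "map h r \<in> perms n" if "bij_betw h {1..n} {1..n}" "r \<in> perms n" for h r
    using that by (auto simp: perms_def permutations_of_set_def distinct_map bij_betw_def)
  have mem: "set r = {1..n}" "distinct r" if "r \<in> perms n" for r
    using that by (auto simp: perms_def permutations_of_set_def)
  have p_map: "map f [1..<Suc n] = p"
    by (rule nth_equalityI) (simp_all add: lp f_Suc del: upt_Suc)
  have "bij_betw (map f) ?R (queuesort_preimage n p)"
  proof (rule bij_betw_byWitness[where f' = "map g"])
    show "\<forall>r\<in>?R. map g (map f r) = r"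
      using gf mem by (auto simp: o_def intro!: map_idI)
    show "\<forall>s\<in>queuesort_preimage n p. map f (map g s) = s"
      using fg mem by (auto simp: o_def queuesort_preimage_def intro!: map_idI)
    show "map f ` ?R \<subseteq> queuesort_preimage n p"
    proof (rule image_subsetI)
      fix r assume "r \<in> ?R"
      then have r: "r \<in> perms n" "avoids_321 r"
        and k: "\<And>k. k \<in> set (maxima_above 0 r) \<Longrightarrow> is_ltr_max p (k - 1) \<and> (k < n \<longrightarrow> is_ltr_max p k)"
        by auto
      have fr: "map f r \<in> perms n" using perms_map bf r by blast
      have k_in: "k \<in> {1..n}" if "k \<in> set (maxima_above 0 r)" for k
        using that maxima_above_subset[of 0 r] mem[OF r(1)] by auto
      have f_pos: "0 < f k" if "k \<in> {1..n}" for k using f_in[OF that] by simp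
      have "bypass (f 0) (map f r) = map f (sort r)"
      proof (rule bypass_avoider[where f = f and T = 0 and n = n])
        show "distinct r" "set r \<subseteq> {..n}" "{0<..n} \<subseteq> set r" "0 \<notin> set r"
          unfolding mem(1)[OF r(1)] using mem(2)[OF r(1)] by (simp_all add: subset_iff)
        show "avoids_321 (0 # r)" using r by (simp add: avoids_321_Cons)
        show "f y < f k" if "k \<in> insert 0 (set (maxima_above 0 r))" "y < k" for k y
        proof -
          have k': "k \<in> set (maxima_above 0 r)" using that by auto
          show ?thesis
          proof (cases y)
            case 0
            then show ?thesis using f_pos[OF k_in[OF k']] f0 by simp
          next
            case (Suc z)
            then have "z < k - 1" "k = Suc (k - 1)" using that by auto
            then show ?thesis using k[OF k'] Suc unfolding is_ltr_max_def by (metis f_Suc)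
          qed
        qed
        show "f k < f (Suc k)" if "k \<in> insert 0 (set (maxima_above 0 r))" "k < n" for k
        proof (cases k)
          case 0
          then show ?thesis using f_pos[of "Suc k"] that f0 by simp
        next
          case (Suc z)
          then show ?thesis using k[of k] that unfolding is_ltr_max_def by (auto simp: f_Suc)
        qed
      qed
      moreover have "sort r = [1..<Suc n]"
        using mem[OF r(1)]
        by (intro sorted_distinct_set_unique)
          (simp_all add: atLeastLessThanSuc_atLeastAtMost del: upt_Suc)
      ultimately have "bypass 0 (map f r) = p" using p_map f0 by (simp del: upt_Suc)
      moreover have "0 \<notin> set (map f r)" using mem[OF fr] by simp
      ultimately show "map f r \<in> queuesort_preimage n p"
        using fr queuesort_eq_bypass by (simp add: queuesort_preimage_def)
    qed
    show "map g ` queuesort_preimage n p \<subseteq> ?R"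
    proof (rule image_subsetI)
      fix s assume s: "s \<in> queuesort_preimage n p"
      then have sp: "s \<in> perms n" by (simp add: queuesort_preimage_def)
      note s_mem = mem[OF sp]
      let ?M = "set (maxima_above 0 s)"
      have ps: "bypass 0 s = p"
        using s s_mem queuesort_eq_bypass[of s] by (simp add: queuesort_preimage_def)
      define r where "r = map g s"
      have rp: "r \<in> perms n" using perms_map bg sp r_def by blast
      note r_mem = mem[OF rp]
      have pos_r: "pos r (g u) = pos s u" if "u \<in> {1..n}" for u
        using that s_mem bg unfolding r_def by (intro pos_map) (auto simp: bij_betw_def)
      \<comment> \<open>An inversion of \<open>r\<close> is a pair of entries of \<open>s\<close>
        whose order Queuesort reverses.\<close>
      have inv: "u \<in> ?M \<and> v \<notin> ?M"
        if "u \<in> {1..n}" "v \<in> {1..n}" "pos r (g u) < pos r (g v)" "g v < g u" for u v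
        using bypass_inversion[of s u v 0] that s_mem ps pos_r by (simp add: g_def)
      have "avoids_321 r"
        unfolding avoids_321_iff_pos[OF r_mem(2)]
      proof (intro ballI impI notI)
        fix u v w
        assume *: "u \<in> set r" "v \<in> set r" "w \<in> set r" "pos r u < pos r v" "pos r v < pos r w"
          "v < u \<and> w < v"
        then obtain u' v' w' where "u = g u'" "v = g v'" "w = g w'"
          "u' \<in> {1..n}" "v' \<in> {1..n}" "w' \<in> {1..n}"
          using s_mem by (auto simp: r_def)
        \<comment> \<open>The middle entry of a pattern would be both a maximum and a non-maximum of
          \<open>s\<close>.\<close>
        then show False using inv[of u' v'] inv[of v' w'] * by auto
      qed
      moreover have "is_ltr_max p (k - 1) \<and> (k < n \<longrightarrow> is_ltr_max p k)"
        if k: "k \<in> set (maxima_above 0 r)" for k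
      proof -
        have "k \<in> set r" and kmax: "\<forall>w\<in>set r. pos r w < pos r k \<longrightarrow> w < k"
          using k maxima_above_iff[OF r_mem(2)] by auto
        then obtain u where u: "k = g u" "u \<in> {1..n}" using s_mem by (auto simp: r_def)
        \<comment> \<open>A maximum of \<open>r\<close> comes from a maximum of \<open>s\<close>:
          otherwise some \<open>q\<close> before \<open>u\<close> would end up behind it, giving
          \<open>r\<close> a larger entry before \<open>k\<close>.\<close>
        have uM: "u \<in> ?M"
        proof (rule ccontr)
          assume "u \<notin> ?M"
          then consider q where "q \<in> ?M" "pos s q < pos s u" "pos p u < pos p q"
            | "\<forall>w\<in>set s. pos p w \<le> pos p u \<longrightarrow> w \<le> 0"
            using bypass_overtaken[of s u 0] u s_mem ps by auto
          then show False
          proof cases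
            case 1
            then have q: "q \<in> {1..n}" using maxima_above_subset[of 0 s] s_mem by auto
            then have "g q < k" using kmax u 1 pos_r[of u] pos_r[of q] g_in r_mem by auto
            then show False using 1 u by (simp add: g_def)
          next
            case 2
            then show False using u s_mem by auto
          qed
        qed
        have pk: "pos p u = k - 1" "k - 1 < n" "p ! (k - 1) = u"
          using u dp lp pos_less_length[of p u] by (auto simp: g_def simp del: pos_less_length)
        have max: "\<forall>j<k - 1. p ! j < p ! (k - 1)"
        proof clarify
          fix j assume j: "j < k - 1"
          then have "j < length p" using pk lp by simp
          then show "p ! j < p ! (k - 1)"
            using bypass_maxima(1)[of s u 0 "p ! j"] s_mem uM dp pk ps j
            by (metis nth_mem pos_nth)
        qed
        then have "is_ltr_max p (k - 1)" using pk lp by (simp add: is_ltr_max_def)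
        moreover have "is_ltr_max p k" if "k < n"
        proof -
          have "k = Suc (k - 1)" using u by (simp add: g_def)
          moreover have "p ! (k - 1) < p ! k"
            using bypass_maxima(2)[of s u 0 "p ! k"] s_mem uM dp pk ps lp that calculation
            by (metis nth_mem pos_nth)
          ultimately show ?thesis
            using max that lp unfolding is_ltr_max_def by (metis less_antisym order_less_trans)
        qed
        ultimately show ?thesis by blast
      qed
      ultimately show "map g s \<in> ?R" using rp unfolding r_def by blast
    qed
  qed
  then show ?thesis by (rule bij_betw_same_card[symmetric])
qed

subsection \<open>Splitting an avoider at a value\<close>

text \<open>The shared entry \<open>q\<close> makes the two parts independent. It can replace any
  left entry as the largest of a pattern whose other entries lie on the right; likewise
  \<open>a\<close> can replace any right entry as the smallest of a pattern whose other entries lie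
  on the left.\<close>

lemma card_avoiders_split:
  assumes "1 \<le> a" "a \<le> b" "b < n"
  shows "card {r \<in> perms n. avoids_321 r \<and> set (maxima_above 0 r) \<inter> {a..b} = {}} =
    (\<Sum>q\<in>{b<..n}. \<Sum>J\<in>Pow {b<..<q}.
      card {A \<in> permutations_of_set (insert q ({1..a} \<union> J)). avoids_321 A \<and> last A = a} *
      card {C \<in> permutations_of_set ({a<..n} - J). avoids_321 C \<and> hd C = q})"
    (is "card ?R = (\<Sum>q\<in>_. \<Sum>J\<in>_. card (?A q J) * card (?C q J))")
proof -
  define S where "S = (SIGMA q:{b<..n}. SIGMA J:Pow {b<..<q}. ?A q J \<times> ?C q J)"
  \<comment> \<open>\<open>C\<close> carries a copy of \<open>q\<close> at its head, which
    \<open>tl\<close> removes.\<close>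
  define glue where "glue = (\<lambda>(q::nat, J::nat set, A, C). A @ tl C :: nat list)"
  have AC: "distinct A" "set A = insert q ({1..a} \<union> J)" "avoids_321 A" "A \<noteq> []" "last A = a"
    "distinct C" "set C = {a<..n} - J" "avoids_321 C" "C = q # tl C" "a \<notin> set (tl C)"
    "J \<subseteq> {b<..<q}" "b < q" "q \<le> n"
    "q \<notin> set (tl C)" "set (tl C) = {a<..n} - J - {q}"
    if "(q, J, A, C) \<in> S" for q J A C
  proof -
    show A: "distinct A" "set A = insert q ({1..a} \<union> J)" "avoids_321 A" "last A = a"
      "distinct C" "set C = {a<..n} - J" "avoids_321 C" "J \<subseteq> {b<..<q}" "b < q" "q \<le> n"
      using that by (auto simp: S_def permutations_of_set_def)
    show "A \<noteq> []" using A(2) by auto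
    have "q \<in> set C" using A(6,8,9,10) assms by auto
    moreover have "hd C = q" using that by (simp add: S_def)
    ultimately show C: "C = q # tl C" by (cases C) auto
    show qC: "q \<notin> set (tl C)" using C A(5) by (metis distinct.simps(2))
    have "set C = insert q (set (tl C))" using C by (metis list.simps(15))
    then show "set (tl C) = {a<..n} - J - {q}" using qC A(6) by auto
    then show "a \<notin> set (tl C)" by simp
  qed
  have pos_last: "pos A a = length A - 1" "k \<in> set A \<Longrightarrow> k \<noteq> a \<Longrightarrow> pos A k < length A - 1"
    if "distinct A" "A \<noteq> []" "last A = a" for A :: "nat list" and k
  proof -
    show *: "pos A a = length A - 1"
      using that pos_nth[of A "length A - 1"] by (simp add: last_conv_nth)
    have "a \<in> set A" using that by (metis last_in_set)
    then show "pos A k < length A - 1" if "k \<in> set A" "k \<noteq> a"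
      using * that pos_less_length[of A k] pos_eq_iff[of k A a]
      by (auto simp del: pos_less_length)
  qed
  \<comment> \<open>The end of \<open>A\<close> is marked by \<open>a\<close>, and \<open>q\<close>
    is the largest of the entries of \<open>A\<close> above \<open>a\<close>, so all components can
    be read off.\<close>
  have "inj_on glue S"
  proof (rule inj_onI)
    fix x y assume xy: "x \<in> S" "y \<in> S" "glue x = glue y"
    obtain q J A C where x: "x = (q, J, A, C)" by (cases x)
    obtain q' J' A' C' where y: "y = (q', J', A', C')" by (cases y)
    note X = AC[OF xy(1)[unfolded x]] and Y = AC[OF xy(2)[unfolded y]]
    have eq: "A @ tl C = A' @ tl C'" using xy(3) by (simp add: x y glue_def)
    have "a \<in> set A" "a \<in> set A'" using X(2) Y(2) assms by auto
    then have "pos (A @ tl C) a = length A - 1" "pos (A' @ tl C') a = length A' - 1"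
      using pos_last(1)[OF X(1,4,5)] pos_last(1)[OF Y(1,4,5)] by (simp_all add: pos_append)
    then have "length A = length A'"
      using eq X(4) Y(4) by (metis One_nat_def Suc_pred length_greater_0_conv)
    then have A: "A = A'" and C: "tl C = tl C'" using eq by auto
    have "insert q J = {y \<in> set A. a < y}" using X(2,11,12) assms by auto
    also have "\<dots> = insert q' J'" using Y(2,11,12) assms A by auto
    finally have J: "insert q J = insert q' J'" .
    have "q \<notin> J" "q' \<notin> J'" "\<forall>k\<in>J. k < q" "\<forall>k\<in>J'. k < q'" using X(11) Y(11) by auto
    with J have "q = q'" by (metis insert_iff less_asym)
    moreover with J \<open>q \<notin> J\<close> \<open>q' \<notin> J'\<close> have "J = J'" by (metis insert_ident)
    ultimately show "x = y" using x y A C X(9) Y(9) by metis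
  qed
  moreover have "glue ` S = ?R"
  proof (intro equalityI subsetI)
    fix r assume "r \<in> glue ` S"
    then obtain z where z: "z \<in> S" "r = glue z" by blast
    obtain q J A C where z': "z = (q, J, A, C)" by (cases z)
    have S: "(q, J, A, C) \<in> S" using z z' by simp
    have r: "r = A @ tl C" using z z' by (simp add: glue_def)
    note X = AC[OF S]
    let ?D = "tl C"
    have AD: "set A \<inter> set ?D = {}" unfolding X(2) X(15) by auto
    have dr: "distinct r" using X(1,6) AD by (simp add: r distinct_tl)
    have sr: "set r = {1..n}"
    proof -
      have "J \<subseteq> {a<..n}" "q \<in> {a<..n}" using X(11,12,13) assms by auto
      then have "insert q ({1..a} \<union> J) \<union> ({a<..n} - J - {q}) = {1..a} \<union> {a<..n}" by blast
      also have "\<dots> = {1..n}" using assms by auto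
      finally show ?thesis unfolding r set_append X(2) X(15) .
    qed
    have qa: "q \<in> set A" "a \<in> set A" "a < q" unfolding X(2) using X(12) assms by auto
    have posC: "pos C u = Suc (pos ?D u)" if "u \<in> set ?D" for u
      using that X(9,14) by (metis pos_Cons)
    have posq: "pos C q = 0" using X(9) by (metis pos_Cons)
    have setC: "set ?D \<subseteq> set C" "q \<in> set C" using X(9) by (metis list.set_intros(1) set_subset_Cons)+
    have Dgt: "a < u" if "u \<in> set ?D" for u using that unfolding X(15) by simp
    have Ale: "u \<le> q" if "u \<in> set A" for u using that X(11,12) assms unfolding X(2) by auto
    note avA = X(3)[unfolded avoids_321_iff_pos[OF X(1)], rule_format]
    note avC = X(8)[unfolded avoids_321_iff_pos[OF X(6)], rule_format]
    have "avoids_321 r"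
      unfolding avoids_321_iff_pos[OF dr]
    proof (intro ballI impI notI)
      fix u v w
      assume mem: "u \<in> set r" "v \<in> set r" "w \<in> set r"
        and pos: "pos r u < pos r v" "pos r v < pos r w" and lt: "v < u \<and> w < v"
      have A_D: "x \<in> set A" if "pos r x < pos r y" "y \<in> set A" for x y
      proof -
        have "pos A y < length A" using that by simp
        with that show ?thesis by (simp add: r pos_append del: pos_less_length split: if_splits)
      qed
      consider "w \<in> set A" | "w \<notin> set A" "v \<in> set A" | "v \<notin> set A" "w \<notin> set A" by blast
      then show False
      proof cases
        case 1
        then have "v \<in> set A" "u \<in> set A" using A_D pos by blast+
        then show False using avA[of u v w] 1 pos lt by (auto simp: r pos_append)
      next
        \<comment> \<open>Replace \<open>w\<close> by \<open>a\<close>, which is smaller and comes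
          last in \<open>A\<close>.\<close>
        case 2
        then have u: "u \<in> set A" and w: "a < w" using A_D pos mem Dgt r by auto
        then have "pos A v < pos A a"
          using pos_last[OF X(1,4,5)] 2 lt by auto
        then show False using avA[of u v a] 2 u w qa pos lt by (auto simp: r pos_append)
      next
        case 3
        then have vw: "v \<in> set ?D" "w \<in> set ?D" using mem r by auto
        then have vw': "pos C v < pos C w" "0 < pos C v" using pos 3 posC by (auto simp: r pos_append)
        show False
        proof (cases "u \<in> set A")
          \<comment> \<open>Replace \<open>u\<close> by \<open>q\<close>, which is at least
            \<open>u\<close> and heads \<open>C\<close>.\<close>
          case True
          then have "v < q" using Ale lt by fastforce
          then show False using avC[of q v w] vw vw' lt posq setC by auto
        next
          case False
          then have "u \<in> set ?D" using mem r by auto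
          then show False using avC[of u v w] vw vw' lt posC pos False 3 setC
            by (auto simp: r pos_append)
        qed
      qed
    qed
    moreover have "k \<notin> set (maxima_above 0 r)" if "k \<in> {a..b}" for k
    proof -
      \<comment> \<open>\<open>A\<close> ends with \<open>a\<close>, and the values above
        \<open>a\<close> up to \<open>b\<close> go to the right part, so the larger entry
        \<open>q\<close> precedes \<open>k\<close>.\<close>
      have "pos r q < pos r k"
      proof (cases "k = a")
        case True
        then show ?thesis using pos_last[OF X(1,4,5)] qa by (auto simp: r pos_append)
      next
        case False
        then have "k \<notin> set A" unfolding X(2) using that X(11,12) by auto
        then show ?thesis using qa pos_less_length[of A q]
          by (auto simp: r pos_append simp del: pos_less_length intro: trans_less_add1)
      qed
      moreover have "q \<in> set r" "k < q" using qa that X(12) by (auto simp: r)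
      ultimately show ?thesis using maxima_above_iff[OF dr] by (metis less_asym)
    qed
    ultimately show "r \<in> ?R"
      using dr sr by (auto simp: perms_def permutations_of_set_def)
  next
    fix r assume "r \<in> ?R"
    then have dr: "distinct r" and sr: "set r = {1..n}" and av: "avoids_321 r"
      and nomax: "\<And>k. k \<in> {a..b} \<Longrightarrow> k \<notin> set (maxima_above 0 r)"
      by (auto simp: perms_def permutations_of_set_def)
    note avr = av[unfolded avoids_321_iff_pos[OF dr], rule_format]
    define i where "i = Suc (pos r a)"
    define A where "A = take i r"
    define D where "D = drop i r"
    have r: "r = A @ D" by (simp add: A_def D_def)
    have ar: "a \<in> set r" using sr assms by simp
    have i: "i \<le> length r" using ar pos_less_length[of r a] by (simp add: i_def Suc_le_eq del: pos_less_length)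
    have lA: "length A = i" using i by (simp add: A_def)
    have dA: "distinct A" "distinct D" "set A \<inter> set D = {}" using dr by (auto simp: r)
    have "last A = a"
      using lA i ar by (subst last_conv_nth) (auto simp: A_def i_def)
    have "A \<noteq> []" using lA i_def by auto
    have A_iff: "x \<in> set A \<longleftrightarrow> pos r x \<le> pos r a" for x
    proof (cases "x \<in> set A")
      case True
      then have "pos r x < length A" by (simp add: r pos_append)
      then show ?thesis using True lA i_def by simp
    next
      case False
      then have "length A \<le> pos r x" by (simp add: r pos_append)
      then show ?thesis using False lA i_def by simp
    qed
    have aA: "a \<in> set A" by (simp add: A_iff)
    have A_sub: "set A \<subseteq> {1..n}" using sr r by auto
    \<comment> \<open>As \<open>a\<close> is no maximum of \<open>r\<close>, a larger entry
      \<open>w0\<close> precedes it.\<close>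
    have "\<not> (\<forall>w\<in>set r. pos r w < pos r a \<longrightarrow> w < a)"
      using nomax[of a] ar assms maxima_above_iff[OF dr, of a 0] by auto
    then obtain w0 where w0: "w0 \<in> set r" "pos r w0 < pos r a" "a < w0"
      by (metis linorder_neqE_nat less_irrefl)
    \<comment> \<open>Otherwise \<open>w0\<close>, \<open>a\<close>, \<open>x\<close> would form the
      pattern.\<close>
    have below: "x \<in> set A" if "x \<in> {1..a}" for x
    proof (rule ccontr)
      assume "x \<notin> set A"
      then have "pos r a < pos r x" "x < a" using A_iff aA that by (auto simp: le_less)
      then show False using avr[of w0 a x] w0 ar sr that assms by auto
    qed
    \<comment> \<open>Otherwise \<open>x\<close> is no maximum, so a larger \<open>w\<close>
      precedes it, and \<open>w\<close>, \<open>x\<close>, \<open>a\<close> would form the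
      pattern.\<close>
    have above: "b < x" if "x \<in> set A" "a < x" for x
    proof (rule ccontr)
      assume "\<not> b < x"
      then have "x \<notin> set (maxima_above 0 r)" using nomax that by simp
      moreover have xr: "x \<in> set r" "0 < x" using that A_sub sr by auto
      ultimately obtain w where w: "w \<in> set r" "pos r w < pos r x" "\<not> w < x"
        using maxima_above_iff[OF dr, of x 0] by blast
      then have "x < w" by (metis linorder_neqE_nat less_irrefl)
      moreover have "pos r x \<noteq> pos r a" using that xr ar by (simp add: pos_eq_iff)
      then have "pos r x < pos r a" using that A_iff by (simp add: le_less)
      ultimately show False using avr[of w x a] w xr ar that by simp
    qed
    define q where "q = Max (set A)"
    have qA: "q \<in> set A" using aA unfolding q_def by (intro Max_in) auto
    have qmax: "x \<le> q" if "x \<in> set A" for x using that by (simp add: q_def)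
    have "w0 \<in> set A" using w0 A_iff by simp
    then have "a < q" using qmax w0 by fastforce
    then have bq: "b < q" using above qA by simp
    define J where "J = set A - {1..a} - {q}"
    have "J \<subseteq> {b<..<q}"
      using above qmax A_sub by (force simp: J_def le_less)
    moreover have sA: "set A = insert q ({1..a} \<union> J)"
      using below qA by (auto simp: J_def)
    have "A \<in> ?A q J"
    proof -
      have "avoids_321 A"
        unfolding avoids_321_iff_pos[OF dA(1)]
      proof (intro ballI impI)
        fix u v w assume "u \<in> set A" "v \<in> set A" "w \<in> set A" "pos A u < pos A v" "pos A v < pos A w"
        then show "\<not> (v < u \<and> w < v)"
          using avr[of u v w] by (simp add: r pos_append)
      qed
      then show ?thesis using dA sA \<open>last A = a\<close> by (simp add: permutations_of_set_def)
    qed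
    moreover have "q # D \<in> ?C q J"
    proof -
      have qD: "q \<notin> set D" using qA dA by auto
      then have dC: "distinct (q # D)" using dA by simp
      have "set D = {1..n} - set A" using dA sr r by auto
      moreover have "insert q ({1..n} - set A) = {a<..n} - J"
      proof (rule set_eqI)
        fix x
        have "q \<le> n" "1 \<le> q" using qA A_sub by auto
        moreover have "a < x" if "x \<notin> set A" "1 \<le> x"
          using that below[of x] by (meson atLeastAtMost_iff not_le)
        ultimately show "x \<in> insert q ({1..n} - set A) \<longleftrightarrow> x \<in> {a<..n} - J"
          using \<open>a < q\<close> by (cases "x = q") (auto simp: J_def)
      qed
      ultimately have "set (q # D) = {a<..n} - J" by simp
      \<comment> \<open>\<open>q # D\<close> is a subsequence of \<open>r\<close>, since
        \<open>q\<close> lies in \<open>A\<close>.\<close>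
      moreover have mono: "pos r u < pos r v" if "pos (q # D) u < pos (q # D) v" "u \<in> set (q # D)" "v \<in> set (q # D)" for u v
      proof -
        have "v \<noteq> q" using that by auto
        then have v: "v \<in> set D" "v \<notin> set A" using that dA by auto
        show ?thesis
        proof (cases "u = q")
          case True
          then show ?thesis using v qA pos_less_length[of A q]
            by (auto simp: r pos_append simp del: pos_less_length intro: trans_less_add1)
        next
          case False
          then have "u \<notin> set A" using that dA by auto
          then show ?thesis using that False \<open>v \<noteq> q\<close> v by (auto simp: r pos_append)
        qed
      qed
      have "avoids_321 (q # D)"
        unfolding avoids_321_iff_pos[OF dC]
      proof (intro ballI impI)
        fix u v w assume *: "u \<in> set (q # D)" "v \<in> set (q # D)" "w \<in> set (q # D)"
          "pos (q # D) u < pos (q # D) v" "pos (q # D) v < pos (q # D) w"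
        have "set (q # D) \<subseteq> set r" using qA by (simp add: r)
        then show "\<not> (v < u \<and> w < v)"
          using avr[of u v w] mono[of u v] mono[of v w] * by blast
      qed
      ultimately show ?thesis using dC by (simp add: permutations_of_set_def)
    qed
    moreover have "q \<le> n" using qA A_sub by auto
    ultimately have "(q, J, A, q # D) \<in> S" using bq by (simp add: S_def)
    moreover have "r = glue (q, J, A, q # D)" by (simp add: glue_def r)
    ultimately show "r \<in> glue ` S" by blast
  qed
  ultimately have "card ?R = card S" by (metis card_image)
  moreover have fin: "finite {b<..<q}" "finite (?A q J)" "finite (?C q J)" if "J \<subseteq> {b<..<q}" for q J
    using that finite_subset[OF that] by auto
  have "card S = (\<Sum>q\<in>{b<..n}. \<Sum>J\<in>Pow {b<..<q}. card (?A q J) * card (?C q J))"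
    unfolding S_def using fin by (simp add: card_SigmaI card_cartesian_product)
  ultimately show ?thesis by simp
qed

section \<open>Summation by subset size\<close>

lemma sum_Pow_card:
  fixes h :: "nat \<Rightarrow> nat"
  assumes "finite S"
  shows "(\<Sum>J\<in>Pow S. h (card J)) = (\<Sum>j = 0..card S. (card S choose j) * h j)"
proof -
  have "(\<Sum>J\<in>Pow S. h (card J)) = (\<Sum>j = 0..card S. \<Sum>J\<in>{J \<in> Pow S. card J = j}. h (card J))"
    using assms by (intro sum.group[symmetric]) (auto intro: card_mono)
  also have "\<dots> = (\<Sum>j = 0..card S. (card S choose j) * h j)"
    using n_subsets[OF assms] by (intro sum.cong) (auto simp: Pow_def)
  finally show ?thesis .
qed

text \<open>A summand depends on \<open>J\<close> only through its size, so the subsets of the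
  \<open>q - b - 1\<close> values between \<open>b\<close> and \<open>q\<close> contribute binomial
  coefficients. The new index is \<open>i = q - b\<close>.\<close>

lemma card_avoiders_ballot:
  assumes "1 \<le> a" "a \<le> b" "b < n"
  shows "card {r \<in> perms n. avoids_321 r \<and> set (maxima_above 0 r) \<inter> {a..b} = {}} =
    (\<Sum>i = 1..n - b. \<Sum>j = 0..i - 1.
      ((i - 1) choose j) * (b_num (a + j + 1) a * b_num (n - a - j) (n - b - i + 1)))"
proof -
  have "card {A \<in> permutations_of_set (insert q ({1..a} \<union> J)). avoids_321 A \<and> last A = a} *
      card {C \<in> permutations_of_set ({a<..n} - J). avoids_321 C \<and> hd C = q} =
      b_num (a + card J + 1) a * b_num (n - a - card J) (n - q + 1)"
    if q: "q \<in> {b<..n}" and J: "J \<subseteq> {b<..<q}" for q J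
  proof -
    have fJ: "finite J" using J finite_subset by blast
    have "{1..a} \<inter> J = {}" "q \<notin> {1..a} \<union> J" using J q assms by auto
    then have "card (insert q ({1..a} \<union> J)) = a + card J + 1"
      using fJ by (simp add: card_Un_disjoint)
    \<comment> \<open>In the left part \<open>a\<close> has rank \<open>a\<close> from below, as
      \<open>q\<close> and \<open>J\<close> lie above it. In the right part \<open>q\<close> has
      rank \<open>n - q + 1\<close> from above, as \<open>J\<close> lies below
      \<open>q\<close>.\<close>
    moreover have "{y \<in> insert q ({1..a} \<union> J). y \<le> a} = {1..a}" using J q assms by auto
    moreover have "card ({a<..n} - J) = n - a - card J"
      using J q assms fJ by (subst card_Diff_subset) auto
    moreover have "{y \<in> {a<..n} - J. q \<le> y} = {q..n}" using J q assms by auto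
    moreover have "q \<in> {a<..n} - J" "a \<in> insert q ({1..a} \<union> J)" using J q assms by auto
    ultimately show ?thesis
      using card_avoiders_last[of "insert q ({1..a} \<union> J)" a] card_avoiders_hd[of "{a<..n} - J" q] q fJ
      by (simp add: Suc_diff_le)
  qed
  then have "card {r \<in> perms n. avoids_321 r \<and> set (maxima_above 0 r) \<inter> {a..b} = {}} =
      (\<Sum>q\<in>{b<..n}. \<Sum>J\<in>Pow {b<..<q}.
        b_num (a + card J + 1) a * b_num (n - a - card J) (n - q + 1))"
    unfolding card_avoiders_split[OF assms] by (intro sum.cong) auto
  also have "\<dots> = (\<Sum>q\<in>{b<..n}. \<Sum>j = 0..card {b<..<q}.
        (card {b<..<q} choose j) * (b_num (a + j + 1) a * b_num (n - a - j) (n - q + 1)))"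
    by (intro sum.cong refl sum_Pow_card[where h = "\<lambda>j. b_num (a + j + 1) a * b_num (n - a - j) (n - _ + 1)"]) simp
  also have "\<dots> = (\<Sum>i = 1..n - b. \<Sum>j = 0..i - 1.
      ((i - 1) choose j) * (b_num (a + j + 1) a * b_num (n - a - j) (n - b - i + 1)))"
    by (rule sum.reindex_bij_witness[of _ "\<lambda>i. b + i" "\<lambda>q. q - b"]) auto
  finally show ?thesis .
qed

theorem theorem4p18:
  fixes n :: nat and p M1 P1 M2 :: "nat list"
  assumes "p \<in> perms n"
    and "ltr_max_decomp p M1 P1 M2"
    and "M2 \<noteq> []"
  shows "card (queuesort_preimage n p) =
    (\<Sum>i = 1..length M2. \<Sum>j = 0..i - 1.
       ((i - 1) choose j)
         * b_num (length M1 + j + 1) (length M1)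
         * b_num (length M2 + length P1 - j) (length M2 - i + 1))"
proof -
  define a b where "a = length M1" and "b = length M1 + length P1"
  have p: "p = M1 @ P1 @ M2" and P1: "P1 \<noteq> []"
    and ltr: "\<And>i. i < length p \<Longrightarrow> is_ltr_max p i \<longleftrightarrow> i < a \<or> b \<le> i"
    using assms(2) unfolding ltr_max_decomp_def a_def b_def by blast+
  have "distinct p" "set p = {1..n}"
    using assms(1) unfolding perms_def by (blast dest: permutations_of_setD)+
  then have lp: "length p = n"
    by (metis card_atLeastAtMost diff_Suc_1 distinct_card)
  have n: "n = b + length M2" using lp p by (simp add: b_def)
  have bn: "b < n" using n assms(3) by simp
  have ab: "a < b" using P1 by (simp add: a_def b_def)
  \<comment> \<open>A first entry is always a maximum, so \<open>M1\<close> cannot be empty.\<close>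
  have "is_ltr_max p 0" using lp bn by (simp add: is_ltr_max_def)
  then have a: "1 \<le> a" using ltr[of 0] lp bn ab by simp
  \<comment> \<open>The indices \<open>k - 1\<close> and \<open>k\<close> must both avoid
    \<open>P1\<close>, which fills the indices \<open>a\<close> to \<open>b - 1\<close>; this
    excludes exactly \<open>a\<close> to \<open>b\<close>. For \<open>k = n\<close> only index
    \<open>n - 1\<close> matters, and it belongs to the nonempty \<open>M2\<close>.\<close>
  have good: "is_ltr_max p (k - 1) \<and> (k < n \<longrightarrow> is_ltr_max p k) \<longleftrightarrow> k \<notin> {a..b}"
    if "k \<in> {1..n}" for k
    using ltr[of "k - 1"] ltr[of k] that lp ab bn by (cases "k < n") auto
  have "(\<forall>k\<in>set (maxima_above 0 r). is_ltr_max p (k - 1) \<and> (k < n \<longrightarrow> is_ltr_max p k)) \<longleftrightarrow>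
      set (maxima_above 0 r) \<inter> {a..b} = {}" if "r \<in> perms n" for r
  proof -
    have "set (maxima_above 0 r) \<subseteq> {1..n}"
      using that maxima_above_subset permutations_of_setD(1) unfolding perms_def by blast
    then show ?thesis using good by blast
  qed
  then have "card (queuesort_preimage n p) =
      card {r \<in> perms n. avoids_321 r \<and> set (maxima_above 0 r) \<inter> {a..b} = {}}"
    unfolding card_queuesort_preimage[OF assms(1)] by (intro arg_cong[of _ _ card]) blast
  also have "\<dots> = (\<Sum>i = 1..n - b. \<Sum>j = 0..i - 1.
      ((i - 1) choose j) * (b_num (a + j + 1) a * b_num (n - a - j) (n - b - i + 1)))"
    using a ab bn by (intro card_avoiders_ballot) simp_all
  also have "n - b = length M2" by (simp add: n)
  also have "n - a = length M2 + length P1" by (simp add: n a_def b_def)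
  finally show ?thesis by (simp only: a_def mult.assoc)
qed

end
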